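(* Let $m\ge 2$ be a natural number. The set of sparse $m$-types has cardinality $t_m$, where $t_m$ is the $m$-th tangent number, and $t_m\le t_m^+$ where $t_m^+$ is the number of sparse vip $m$-types.
   Context: The tangent numbers are defined by $\tan(x)=\sum_{n=1}^{\infty} t_n\frac{x^{2n-1}}{(2n-1)!}$, equivalently $t_1=1$ and $t_n=\sum_{i=1}^{n-1}\binom{2n-2}{2i-1}t_it_{n-i}$ for $n\ge 2$. The paper's standing convention is that $m$ is a natural number with $m\ge 2$. ${}^{n\ge}2$ is the set of $0$-$1$ sequences of length $\le n$; $\lg(s)$ is the length of $s$, $\subseteq$ is end-extension, $s\wedge t$ (the meet) is the longest common initial segment of $s$ and $t$. The meet closure of $A$ is $A^{\wedge}=\{s\wedge t: s,t\in A\}\supseteq A$. A set of sequences is transverse if distinct elements have different lengths. $A$ is diagonal if it is an antichain (pairwise $\subseteq$-incomparable) and $A^\wedge$ is transverse. $A$ is sparse if for all $t\in A$ and $s\in A^\wedge\setminus\{t\}$: $\lg(s)<\lg(t)$ and $t(\lg(s))=1$ imply $s\subseteq t$. For a tree $T$ of sequences closed under initial segments, $T(\alpha)$ is the set of its nodes of length $\alpha$. A well-ordering of the levels of $T$ is a linear order of $T$ extending the length order ($\lg(s)<\lg(t)$ implies $s\prec t$) that well-orders each level. For a sparse diagonal set $D$, a $D$-vip order on $T$ is a well-ordering $\prec$ of the levels of $T$ such that for every $d\in D^\wedge$, $d$ is the $\prec$-least element of $T(\lg(d))$, and for all $u,v\in T(\lg(d))\setminus\{d\}$, if $d\wedge u\subsetneq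 d\wedge v\neq d$ then $u\prec v$ (the paper's general definition has one more clause, which is vacuous when $D$ is sparse). A sparse $m$-type is a subtree $\tau$ of ${}^{2m-2\ge}2$, closed under initial segments, whose set $L$ of leaves is an $m$-element sparse diagonal set. A sparse vip $m$-type is a pair $(\tau,\lessdot)$ where $\tau$ is a sparse $m$-type with leaf set $L$ and $\lessdot$ is an $L$-vip order on $\tau$. *)

theory Defs
  imports
    "HOL-Computational_Algebra.Formal_Power_Series"
    "HOL-Library.Sublist"
begin

text \<open>
  The coefficient of \<open>x ^ (2 n - 1)\<close> in the power series of \<open>tan x\<close> is
  \<open>t\<^sub>n / (2 n - 1)!\<close> for \<open>n \<ge> 1\<close>.
\<close>
definition tangent_number :: "nat \<Rightarrow> real" where
  "tangent_number n = fact (2 * n - 1) * fps_nth (fps_tan 1) (2 * n - 1)"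

text \<open>
  A 0-1 sequence is a \<^typ>\<open>bool list\<close>, \<^const>\<open>True\<close> standing for \<open>1\<close>;
  \<open>lg\<close> is \<^const>\<open>length\<close> and end-extension is \<^const>\<open>prefix\<close>.
\<close>
abbreviation meet :: "bool list \<Rightarrow> bool list \<Rightarrow> bool list" where
  "meet \<equiv> longest_common_prefix"

definition meet_closure :: "bool list set \<Rightarrow> bool list set" where
  "meet_closure A = {meet s t | s t. s \<in> A \<and> t \<in> A}"

definition transverse :: "bool list set \<Rightarrow> bool" where
  "transverse A \<longleftrightarrow> (\<forall>s\<in>A. \<forall>t\<in>A. s \<noteq> t \<longrightarrow> length s \<noteq> length t)"

definition diagonal :: "bool list set \<Rightarrow> bool" where
  "diagonal A \<longleftrightarrow>
     (\<forall>s\<in>A. \<forall>t\<in>A. s \<noteq> t \<longrightarrow> s \<parallel> t) \<and> transverse (meet_closure A)"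

definition sparse :: "bool list set \<Rightarrow> bool" where
  "sparse A \<longleftrightarrow>
     (\<forall>t\<in>A. \<forall>s\<in>meet_closure A - {t}.
        length s < length t \<and> t ! length s = True \<longrightarrow> prefix s t)"

definition initial_closed :: "bool list set \<Rightarrow> bool" where
  "initial_closed T \<longleftrightarrow> (\<forall>t\<in>T. \<forall>s. prefix s t \<longrightarrow> s \<in> T)"

definition level :: "bool list set \<Rightarrow> nat \<Rightarrow> bool list set" where
  "level T n = {t \<in> T. length t = n}"

definition leaves :: "bool list set \<Rightarrow> bool list set" where
  "leaves T = {t \<in> T. \<forall>s\<in>T. \<not> strict_prefix t s}"

text \<open>
  Orders are strict.  The requirement \<open>r \<subseteq> T \<times> T\<close> makes the relation \<open>r\<close> carry no
  information outside \<open>T\<close>, so that counting relations counts orders of \<open>T\<close>.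
\<close>
definition level_well_ordering ::
  "bool list set \<Rightarrow> (bool list \<times> bool list) set \<Rightarrow> bool" where
  "level_well_ordering T r \<longleftrightarrow>
     r \<subseteq> T \<times> T \<and> strict_linear_order_on T r \<and>
     (\<forall>s\<in>T. \<forall>t\<in>T. length s < length t \<longrightarrow> (s, t) \<in> r) \<and>
     (\<forall>n. wf (Restr r (level T n)))"

text \<open>
  Intended for sparse diagonal \<open>D\<close>; for general diagonal \<open>D\<close> a vip order has a further
  clause, which is vacuous when \<open>D\<close> is sparse.
\<close>
definition vip_order ::
  "bool list set \<Rightarrow> bool list set \<Rightarrow> (bool list \<times> bool list) set \<Rightarrow> bool" where
  "vip_order D T r \<longleftrightarrow>
     level_well_ordering T r \<and>
     (\<forall>d\<in>meet_closure D.
        d \<in> T \<and>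
        (\<forall>u\<in>level T (length d) - {d}. (d, u) \<in> r) \<and>
        (\<forall>u\<in>level T (length d) - {d}. \<forall>v\<in>level T (length d) - {d}.
           strict_prefix (meet d u) (meet d v) \<and> meet d v \<noteq> d \<longrightarrow> (u, v) \<in> r))"

definition sparse_type :: "nat \<Rightarrow> bool list set \<Rightarrow> bool" where
  "sparse_type m \<tau> \<longleftrightarrow>
     \<tau> \<subseteq> {s. length s \<le> 2 * m - 2} \<and> initial_closed \<tau> \<and>
     finite (leaves \<tau>) \<and> card (leaves \<tau>) = m \<and> sparse (leaves \<tau>) \<and> diagonal (leaves \<tau>)"

definition sparse_vip_type ::
  "nat \<Rightarrow> bool list set \<times> (bool list \<times> bool list) set \<Rightarrow> bool" where
  "sparse_vip_type m = (\<lambda>(\<tau>, r). sparse_type m \<tau> \<and> vip_order (leaves \<tau>) \<tau> r)"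

end

theory Submission
  imports Defs
begin

text \<open>
  A sparse \<open>m\<close>-type is determined by its set \<open>L\<close> of \<open>m\<close> leaves.  Being the leaves of a binary tree,
  they have \<open>2 m - 1\<close> meets, themselves included (\<open>card_meet_closure\<close>), all of different lengths at most
  \<open>2 m - 2\<close>; so the meets occupy each of the levels \<open>0, \<dots>, 2 m - 2\<close> exactly once, and sparseness says that a leaf has
  the value 1 only where it passes through a branching node.

  To count such sets \<open>L\<close>, prescribe more generally an arbitrary finite set \<open>A\<close> of levels for the
  meets, and require 1 to occur only at branching nodes.  The first bit splits the set into two halves
  of the same kind.  If the least level of \<open>A\<close> is 0 and \<open>A \<noteq> {0}\<close>, the root branches and the other
  levels are shared out between the halves in an arbitrary way; if 0 is not in \<open>A\<close>, all
  sequences start with 0.  So the number of possible sets depends only on \<open>n = card A\<close>, and these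
  numbers \<open>g n\<close> satisfy \<open>g (n + 1) = (\<Sum>k\<le>n. (n choose k) * g k * g (n - k))\<close> for \<open>n > 0\<close>, with \<open>g 0 = 0\<close>
  and \<open>g 1 = 1\<close>.  This is the equation \<open>tan' = 1 + tan\<^sup>2\<close> in terms of \<open>n!\<close> times the coefficients of the
  tangent series (\<open>card_sparse_diags_on\<close>, \<open>tan_coeff_Suc\<close>), and for \<open>n = 2 m - 1\<close> it gives the tangent number.

  For the inequality it is enough that every sparse type carries a vip order.  One is obtained by
  ordering each level by the length of the meet with the unique element of the meet closure on that
  level (\<open>vip_order_exists\<close>).
\<close>

section \<open>Sets of sequences that branch where they take the value 1\<close>

definition prefix_free :: "bool list set \<Rightarrow> bool" where
  "prefix_free L \<longleftrightarrow> (\<forall>s\<in>L. \<forall>t\<in>L. prefix s t \<longrightarrow> s = t)"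

text \<open>
  The form of sparseness used for counting: a sequence may take the value 1 only at its own
  branching nodes.  Unlike \<^const>\<open>sparse\<close>, it also forces 0 at lengths at which no meet lies, and
  it speaks of the nodes below \<open>t\<close> alone, so it passes to the two halves of a split set.  For a
  diagonal set whose meets occupy every level below its leaves, the two conditions agree.
\<close>
definition ones_at_meets :: "bool list set \<Rightarrow> bool" where
  "ones_at_meets L \<longleftrightarrow> (\<forall>t\<in>L. \<forall>l<length t. t ! l \<longrightarrow> take l t \<in> meet_closure L)"

definition sparse_diag :: "bool list set \<Rightarrow> bool" where
  "sparse_diag L \<longleftrightarrow> prefix_free L \<and> inj_on length (meet_closure L) \<and> ones_at_meets L"

text \<open>
  Nonemptiness makes \<open>sparse_diags_on {}\<close> empty, in accordance with the zero constant term of the tangent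
  series; a sum over all ways to distribute levels to two halves then needs no side condition.
\<close>
definition sparse_diags_on :: "nat set \<Rightarrow> bool list set set" where
  "sparse_diags_on A = {L. L \<noteq> {} \<and> sparse_diag L \<and> length ` meet_closure L = A}"

section \<open>Splitting by the first bit\<close>

definition join :: "bool list set \<Rightarrow> bool list set \<Rightarrow> bool list set" where
  "join X Y = Cons False ` X \<union> Cons True ` Y"

lemma join_memb [simp]:
  "[] \<notin> join X Y" "b # t \<in> join X Y \<longleftrightarrow> (if b then t \<in> Y else t \<in> X)"
  by (auto simp: join_def)

lemma ball_join: "(\<forall>s\<in>join X Y. P s) \<longleftrightarrow> (\<forall>x\<in>X. P (False # x)) \<and> (\<forall>y\<in>Y. P (True # y))"
  by (auto simp: join_def)

lemma join_inject [simp]: "join X Y = join X' Y' \<longleftrightarrow> X = X' \<and> Y = Y'"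
proof
  assume eq: "join X Y = join X' Y'"
  have "False # x \<in> join X Y \<longleftrightarrow> False # x \<in> join X' Y'"
    "True # x \<in> join X Y \<longleftrightarrow> True # x \<in> join X' Y'" for x
    by (simp_all only: eq)
  then show "X = X' \<and> Y = Y'" by (simp add: set_eq_iff)
qed simp

lemma join_empty [simp]: "join X Y = {} \<longleftrightarrow> X = {} \<and> Y = {}"
  by (auto simp: join_def)

lemma finite_join [simp]: "finite (join X Y) \<longleftrightarrow> finite X \<and> finite Y"
  by (auto simp: join_def finite_image_iff)

lemma card_join: "finite X \<Longrightarrow> finite Y \<Longrightarrow> card (join X Y) = card X + card Y"
  unfolding join_def by (subst card_Un_disjoint) (auto simp: card_image)

lemma length_join: "length ` join X Y = Suc ` (length ` X \<union> length ` Y)"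
  by (simp add: join_def image_Un image_image)

lemma prefix_freeD: "prefix_free L \<Longrightarrow> s \<in> L \<Longrightarrow> t \<in> L \<Longrightarrow> prefix s t \<Longrightarrow> s = t"
  by (simp add: prefix_free_def)

text \<open>
  The empty sequence is a prefix of everything, so it can only occur alone; otherwise the first
  bit splits the set.
\<close>
lemma prefix_free_cases:
  assumes "prefix_free L"
  obtains "L = {[]}" | X Y where "L = join X Y"
proof (cases "[] \<in> L")
  case True
  then have "t = []" if "t \<in> L" for t
    using prefix_freeD[OF assms True that] by simp
  then have "L = {[]}" using True by blast
  then show ?thesis by (rule that)
next
  case False
  have "t \<in> join {x. False # x \<in> L} {y. True # y \<in> L} \<longleftrightarrow> t \<in> L" for t
    using False by (cases t) auto
  then have "L = join {x. False # x \<in> L} {y. True # y \<in> L}" by blast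
  then show ?thesis by (rule that(2))
qed

section \<open>Meets\<close>

lemma meet_closure_iff: "u \<in> meet_closure L \<longleftrightarrow> (\<exists>s\<in>L. \<exists>t\<in>L. u = meet s t)"
  by (auto simp: meet_closure_def)

lemma meet_self [simp]: "meet s s = s"
  by (induction s) auto

lemma subset_meet_closure: "L \<subseteq> meet_closure L"
  unfolding meet_closure_def by (force intro: meet_self[symmetric])

lemma meet_closure_empty [simp]: "meet_closure {} = {}"
  by (simp add: meet_closure_def)

lemma meet_closure_eq_empty [simp]: "meet_closure L = {} \<longleftrightarrow> L = {}"
  using subset_meet_closure by fastforce

lemma meet_closure_Nil [simp]: "meet_closure {[]} = {[]}"
  by (simp add: meet_closure_def)

lemma finite_meet_closure: "finite L \<Longrightarrow> finite (meet_closure L)"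
  by (simp add: meet_closure_def finite_image_set2)

text \<open>
  Sequences with the same first bit have their meet inside their own half; sequences from
  different halves meet at the root, the only meet that a split creates.
\<close>
lemma meet_closure_join:
  "meet_closure (join X Y) =
     join (meet_closure X) (meet_closure Y) \<union> (if X \<noteq> {} \<and> Y \<noteq> {} then {[]} else {})"
proof (rule set_eqI)
  fix u
  show "u \<in> meet_closure (join X Y) \<longleftrightarrow> u \<in> join (meet_closure X) (meet_closure Y) \<union>
      (if X \<noteq> {} \<and> Y \<noteq> {} then {[]} else {})"
  proof (cases u)
    case Nil
    have "u \<in> meet_closure (join X Y) \<longleftrightarrow> X \<noteq> {} \<and> Y \<noteq> {}"
      unfolding meet_closure_iff Nil join_def by (auto simp: bex_Un)
    then show ?thesis by (simp add: Nil)
  next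
    case (Cons b v)
    have "u \<in> meet_closure (join X Y) \<longleftrightarrow> v \<in> meet_closure (if b then Y else X)"
      unfolding meet_closure_iff Cons join_def by (cases b) (auto simp: bex_Un)
    then show ?thesis by (simp add: Cons)
  qed
qed

lemma prefix_free_join [simp]: "prefix_free (join X Y) \<longleftrightarrow> prefix_free X \<and> prefix_free Y"
  by (auto simp: prefix_free_def ball_join)

text \<open>
  A finite binary tree with \<open>k\<close> leaves has \<open>k - 1\<close> branching nodes.  The induction follows the
  first bit: joining two nonempty halves adds exactly the root to the meets.
\<close>
lemma card_meet_closure:
  assumes "finite L" "L \<noteq> {}" "prefix_free L"
  shows "Suc (card (meet_closure L)) = 2 * card L"
proof -
  have "Suc (card (meet_closure L)) = 2 * card L"
    if "finite L" "L \<noteq> {}" "prefix_free L" "\<forall>t\<in>L. length t < n" for n L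
    using that
  proof (induction n arbitrary: L)
    case (Suc n)
    from Suc.prems(3) show ?case
    proof (cases rule: prefix_free_cases)
      case (2 X Y)
      have fin: "finite X" "finite Y" and pf: "prefix_free X" "prefix_free Y"
        and len: "\<forall>t\<in>X. length t < n" "\<forall>t\<in>Y. length t < n"
        using Suc.prems by (auto simp: 2 ball_join)
      have IH: "X \<noteq> {} \<Longrightarrow> Suc (card (meet_closure X)) = 2 * card X"
        "Y \<noteq> {} \<Longrightarrow> Suc (card (meet_closure Y)) = 2 * card Y"
        using Suc.IH fin pf len by blast+
      show ?thesis
        using Suc.prems(2) IH fin
        by (cases "X = {}"; cases "Y = {}")
           (simp_all add: 2 meet_closure_join card_join finite_meet_closure)
    qed simp
  qed auto
  moreover have "\<forall>t\<in>L. length t < Suc (Max (length ` L))"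
    using assms(1) by (simp add: less_Suc_eq_le)
  ultimately show ?thesis using assms by blast
qed

text \<open>
  The asymmetric condition comes from the bit at level 0: a sequence that starts with 1 needs a
  meet at the root, hence a sequence that starts with 0.
\<close>
lemma ones_at_meets_join [simp]:
  "ones_at_meets (join X Y) \<longleftrightarrow> ones_at_meets X \<and> ones_at_meets Y \<and> (Y \<noteq> {} \<longrightarrow> X \<noteq> {})"
  by (auto simp: ones_at_meets_def ball_join meet_closure_join All_less_Suc2)

lemma inj_on_length_join:
  "inj_on length (join X Y) \<longleftrightarrow>
     inj_on length X \<and> inj_on length Y \<and> length ` X \<inter> length ` Y = {}"
  by (fastforce simp: inj_on_def ball_join)

section \<open>Recursive structure of the families with prescribed levels\<close>

text \<open>
  All conditions are inherited by and from the two halves, which interact only in that their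
  meets must lie on different levels.
\<close>
lemma sparse_diag_join:
  "sparse_diag (join X Y) \<longleftrightarrow> sparse_diag X \<and> sparse_diag Y \<and> (Y \<noteq> {} \<longrightarrow> X \<noteq> {}) \<and>
     length ` meet_closure X \<inter> length ` meet_closure Y = {}"
proof -
  have "inj_on length (meet_closure (join X Y)) \<longleftrightarrow>
      inj_on length (join (meet_closure X) (meet_closure Y))"
    by (auto simp: meet_closure_join length_join inj_on_insert)
  then show ?thesis by (auto simp: sparse_diag_def inj_on_length_join)
qed

lemma sparse_diag_Nil [simp]: "sparse_diag {[]}"
  by (simp add: sparse_diag_def prefix_free_def ones_at_meets_def)

lemma sparse_diag_empty [simp]: "sparse_diag {}"
  by (simp add: sparse_diag_def prefix_free_def ones_at_meets_def)

lemma sparse_diag_cases: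
  assumes "sparse_diag L"
  obtains "L = {[]}" | X Y where "L = join X Y"
  using assms prefix_free_cases by (auto simp: sparse_diag_def)

lemma sparse_diags_on_empty [simp]: "sparse_diags_on {} = {}"
  by (auto simp: sparse_diags_on_def)

lemma sparse_diags_on_zero: "sparse_diags_on {0} = {{[]}}"
proof -
  have "L = {[]}" if "L \<in> sparse_diags_on {0}" for L
  proof -
    have "L \<noteq> {}" "length ` L \<subseteq> {0}"
      using that subset_meet_closure[of L] by (auto simp: sparse_diags_on_def)
    then show ?thesis by auto
  qed
  then show ?thesis by (auto simp: sparse_diags_on_def)
qed

text \<open>
  If level 0 carries no meet, there is no branching at the root, and the common first bit has
  to be 0.
\<close>
lemma sparse_diags_on_Suc: "sparse_diags_on (Suc ` B) = (\<lambda>X. join X {}) ` sparse_diags_on B"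
proof (intro equalityI subsetI)
  fix L assume L: "L \<in> sparse_diags_on (Suc ` B)"
  then have "sparse_diag L" by (simp add: sparse_diags_on_def)
  then show "L \<in> (\<lambda>X. join X {}) ` sparse_diags_on B"
  proof (cases rule: sparse_diag_cases)
    case 1
    then show ?thesis using L by (auto simp: sparse_diags_on_def)
  next
    case (2 X Y)
    have gd: "sparse_diag (join X Y)" "join X Y \<noteq> {}"
      and len: "length ` meet_closure (join X Y) = Suc ` B"
      using L by (auto simp: sparse_diags_on_def 2)
    have "0 \<notin> length ` meet_closure (join X Y)" by (simp add: len)
    then have "Y = {}" "X \<noteq> {}"
      using gd by (auto simp: meet_closure_join sparse_diag_join split: if_splits)
    then have "X \<in> sparse_diags_on B"
      using gd len by (simp add: sparse_diags_on_def meet_closure_join sparse_diag_join length_join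
          inj_image_eq_iff)
    then show ?thesis using 2 \<open>Y = {}\<close> by blast
  qed
next
  fix L assume "L \<in> (\<lambda>X. join X {}) ` sparse_diags_on B"
  then obtain X where "X \<in> sparse_diags_on B" and "L = join X {}" by blast
  then show "L \<in> sparse_diags_on (Suc ` B)"
    by (simp add: sparse_diags_on_def meet_closure_join sparse_diag_join length_join)
qed

text \<open>
  If the root is a meet, the remaining levels are split between the two halves, and any choice
  of members of the two families on these parts is allowed.
\<close>
lemma sparse_diags_on_insert_zero:
  assumes "B \<noteq> {}"
  shows "sparse_diags_on (insert 0 (Suc ` B)) =
    (\<lambda>(C, X, Y). join X Y) `
    (SIGMA C : Pow B. sparse_diags_on C \<times> sparse_diags_on (B - C))"
proof (intro equalityI subsetI)
  fix L assume L: "L \<in> sparse_diags_on (insert 0 (Suc ` B))"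
  then have "sparse_diag L" by (simp add: sparse_diags_on_def)
  then show "L \<in> (\<lambda>(C, X, Y). join X Y) `
    (SIGMA C : Pow B. sparse_diags_on C \<times> sparse_diags_on (B - C))"
  proof (cases rule: sparse_diag_cases)
    case 1
    then show ?thesis using L assms by (auto simp: sparse_diags_on_def)
  next
    case (2 X Y)
    let ?C = "length ` meet_closure X" and ?D = "length ` meet_closure Y"
    have gd: "sparse_diag (join X Y)"
      and len: "length ` meet_closure (join X Y) = insert 0 (Suc ` B)"
      using L by (auto simp: sparse_diags_on_def 2)
    have "0 \<in> length ` meet_closure (join X Y)" by (simp add: len)
    then have ne: "X \<noteq> {}" "Y \<noteq> {}"
      by (auto simp: meet_closure_join length_join split: if_splits)
    then have "insert 0 (Suc ` (?C \<union> ?D)) = insert 0 (Suc ` B)"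
      using len by (simp add: meet_closure_join length_join)
    then have "Suc ` (?C \<union> ?D) = Suc ` B"
      by (metis (no_types, lifting) Diff_insert_absorb image_iff nat.simps(3))
    then have "?C \<union> ?D = B" by (simp only: inj_image_eq_iff[OF inj_Suc])
    moreover have "?C \<inter> ?D = {}" using gd by (simp add: sparse_diag_join)
    ultimately have "?C \<subseteq> B" "?D = B - ?C" by auto
    then have "(?C, X, Y) \<in> (SIGMA C : Pow B. sparse_diags_on C \<times> sparse_diags_on (B - C))"
      using gd ne by (simp add: sparse_diags_on_def sparse_diag_join)
    then show ?thesis unfolding 2 by (rule rev_image_eqI) simp
  qed
next
  fix L assume "L \<in> (\<lambda>(C, X, Y). join X Y) `
    (SIGMA C : Pow B. sparse_diags_on C \<times> sparse_diags_on (B - C))"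
  then obtain C X Y where C: "C \<subseteq> B" "X \<in> sparse_diags_on C" "Y \<in> sparse_diags_on (B - C)" and "L = join X Y"
    by auto
  moreover have "C \<union> (B - C) = B" using C by auto
  ultimately show "L \<in> sparse_diags_on (insert 0 (Suc ` B))"
    by (simp add: sparse_diags_on_def meet_closure_join sparse_diag_join length_join)
qed

text \<open>
  Every leaf belongs to the meet closure, so the levels bound the lengths of the sequences.
\<close>
lemma finite_sparse_diags_on:
  assumes "finite A"
  shows "finite (sparse_diags_on A)"
proof (rule finite_subset)
  let ?S = "{s :: bool list. set s \<subseteq> UNIV \<and> length s \<le> Max A}"
  show "sparse_diags_on A \<subseteq> Pow ?S"
    using subset_meet_closure assms by (fastforce simp: sparse_diags_on_def)
  show "finite (Pow ?S)"
    using finite_lists_length_le[of "UNIV :: bool set" "Max A"] by simp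
qed

section \<open>Coefficients of the tangent series\<close>

text \<open>
  The coefficients of the exponential generating function \<open>tan x = (\<Sum>n. tan_coeff n * x ^ n / n!)\<close>;
  the entries with odd index are the tangent numbers.
\<close>
definition tan_coeff :: "nat \<Rightarrow> real" where
  "tan_coeff n = fact n * fps_nth (fps_tan 1) n"

lemma fps_deriv_tan: "fps_deriv (fps_tan (1::real)) = 1 + fps_tan 1 ^ 2"
proof -
  let ?c = "fps_cos (1::real)" and ?s = "fps_sin (1::real)"
  have c0: "fps_nth ?c 0 \<noteq> 0" by simp
  then have unit: "is_unit (?c ^ 2)" by (simp add: fps_is_unit_iff power2_eq_square)
  have "fps_tan 1 * ?c = ?s"
    unfolding fps_tan_def using c0 by (simp add: fps_divide_unit mult.assoc inverse_mult_eq_1)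
  \<comment> \<open>Clearing denominators reduces the claim to \<open>cos\<^sup>2 + sin\<^sup>2 = 1\<close>.\<close>
  then have "(1 + fps_tan 1 ^ 2) * ?c ^ 2 = ?c ^ 2 + ?s ^ 2"
    by (metis distrib_right mult_1 power_mult_distrib)
  also have "\<dots> = 1" by (rule fps_sin_cos_sum_of_squares)
  finally have "1 + fps_tan 1 ^ 2 = 1 div ?c ^ 2"
    using unit by (metis nonzero_mult_div_cancel_right not_is_unit_0)
  then show ?thesis by (simp add: fps_tan_deriv)
qed

lemma tan_coeff_0 [simp]: "tan_coeff 0 = 0"
  by (simp add: tan_coeff_def fps_tan_def fps_divide_unit)

text \<open>
  The differential equation \<open>tan' = 1 + tan\<^sup>2\<close> read coefficientwise: squaring an exponential
  generating function is binomial convolution.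
\<close>
lemma tan_coeff_Suc:
  "tan_coeff (Suc n) =
     (if n = 0 then 1 else 0) + (\<Sum>k\<le>n. real (n choose k) * (tan_coeff k * tan_coeff (n - k)))"
proof -
  let ?T = "fps_tan (1::real)"
  have "fps_nth (fps_deriv ?T) n = fps_nth (1 + ?T ^ 2) n"
    by (simp only: fps_deriv_tan)
  then have "real (Suc n) * fps_nth ?T (Suc n) =
      (if n = 0 then 1 else 0) + (\<Sum>k\<le>n. fps_nth ?T k * fps_nth ?T (n - k))"
    by (simp add: power2_eq_square fps_mult_nth atLeast0AtMost)
  moreover have "tan_coeff (Suc n) = fact n * (real (Suc n) * fps_nth ?T (Suc n))"
    by (simp add: tan_coeff_def algebra_simps)
  ultimately have "tan_coeff (Suc n) =
      fact n * ((if n = 0 then 1 else 0) + (\<Sum>k\<le>n. fps_nth ?T k * fps_nth ?T (n - k)))"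
    by (simp only:)
  also have "\<dots> = (if n = 0 then 1 else 0) +
      (\<Sum>k\<le>n. fact n * (fps_nth ?T k * fps_nth ?T (n - k)))"
    by (simp add: distrib_left sum_distrib_left)
  also have "(\<Sum>k\<le>n. fact n * (fps_nth ?T k * fps_nth ?T (n - k))) =
      (\<Sum>k\<le>n. real (n choose k) * (tan_coeff k * tan_coeff (n - k)))"
    by (intro sum.cong refl) (simp add: tan_coeff_def binomial_fact)
  finally show ?thesis .
qed

section \<open>The number of sets with prescribed levels\<close>

lemma sum_Pow_card:
  fixes f :: "nat \<Rightarrow> real"
  assumes "finite B"
  shows "(\<Sum>C\<in>Pow B. f (card C)) = (\<Sum>k\<le>card B. real (card B choose k) * f k)"
proof -
  have "(\<Sum>C\<in>Pow B. f (card C)) = (\<Sum>k\<le>card B. \<Sum>C\<in>{C \<in> Pow B. card C = k}. f (card C))"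
    using assms by (intro sum.group[symmetric]) (auto intro: card_mono)
  also have "\<dots> = (\<Sum>k\<le>card B. real (card B choose k) * f k)"
    using assms by (intro sum.cong refl) (simp add: n_subsets)
  finally show ?thesis .
qed

text \<open>
  By \<open>sparse_diags_on_Suc\<close> and \<open>sparse_diags_on_insert_zero\<close> the count depends only on the number of levels
  and satisfies the recursion of \<open>tan_coeff_Suc\<close>: distributing the levels above the root to the
  two halves is the same binomial convolution.  The single level set \<open>{0}\<close>, whose only member
  is a lone leaf, supplies the term 1 of the differential equation.  The induction is on a bound for
  the levels, because removing the bottom level shifts the remaining ones down.
\<close>
lemma card_sparse_diags_on:
  assumes "finite A"
  shows "real (card (sparse_diags_on A)) = tan_coeff (card A)"
proof -
  have "real (card (sparse_diags_on A)) = tan_coeff (card A)" if "A \<subseteq> {..<n}" for n A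
    using that
  proof (induction n arbitrary: A)
    case 0
    then show ?case by simp
  next
    case (Suc n)
    define B where "B = {k. Suc k \<in> A}"
    have B: "B \<subseteq> {..<n}" using Suc.prems by (auto simp: B_def)
    then have fin: "finite B" by (rule finite_subset) simp
    have A: "A = (if 0 \<in> A then insert 0 (Suc ` B) else Suc ` B)"
    proof (rule set_eqI)
      show "k \<in> A \<longleftrightarrow> k \<in> (if 0 \<in> A then insert 0 (Suc ` B) else Suc ` B)" for k
        by (cases k) (auto simp: B_def)
    qed
    consider "A = Suc ` B" | "A = {0}" "B = {}" | "A = insert 0 (Suc ` B)" "B \<noteq> {}"
      using A by (cases "0 \<in> A"; cases "B = {}") auto
    then show ?case
    proof cases
      case 1
      have "card (sparse_diags_on A) = card (sparse_diags_on B)"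
        unfolding 1 sparse_diags_on_Suc by (intro card_image inj_onI) simp
      then show ?thesis using Suc.IH[OF B] 1 by (simp add: card_image)
    next
      case 2
      then show ?thesis
        by (simp add: sparse_diags_on_zero tan_coeff_Suc)
    next
      case 3
      have inj: "inj_on (\<lambda>(C, X, Y). join X Y)
          (SIGMA C : Pow B. sparse_diags_on C \<times> sparse_diags_on (B - C))"
        by (auto simp: inj_on_def sparse_diags_on_def)
      have "real (card (sparse_diags_on A)) =
          (\<Sum>C\<in>Pow B. real (card (sparse_diags_on C)) * real (card (sparse_diags_on (B - C))))"
        unfolding 3(1) sparse_diags_on_insert_zero[OF 3(2)] card_image[OF inj]
        using fin by (subst card_SigmaI)
          (auto intro: finite_sparse_diags_on finite_subset simp: card_cartesian_product)
      also have "\<dots> = (\<Sum>C\<in>Pow B. tan_coeff (card C) * tan_coeff (card B - card C))"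
      proof (rule sum.cong[OF refl])
        fix C assume "C \<in> Pow B"
        then have "C \<subseteq> {..<n}" "B - C \<subseteq> {..<n}" "card (B - C) = card B - card C"
          using B fin by (auto intro: card_Diff_subset finite_subset)
        then show "real (card (sparse_diags_on C)) * real (card (sparse_diags_on (B - C))) =
            tan_coeff (card C) * tan_coeff (card B - card C)"
          using Suc.IH by simp
      qed
      also have "\<dots> = (\<Sum>k\<le>card B. real (card B choose k) * (tan_coeff k * tan_coeff (card B - k)))"
        by (rule sum_Pow_card[OF fin])
      also have "\<dots> = tan_coeff (Suc (card B))"
        using 3(2) fin by (simp add: tan_coeff_Suc)
      also have "Suc (card B) = card A"
        using fin by (simp add: 3(1) card_image)
      finally show ?thesis .
    qed
  qed
  moreover have "A \<subseteq> {..<Suc (Max A)}"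
    using assms by (auto simp: less_Suc_eq_le)
  ultimately show ?thesis by blast
qed

section \<open>Sparse types and their leaves\<close>

definition initial_segments :: "bool list set \<Rightarrow> bool list set" where
  "initial_segments L = {s. \<exists>t\<in>L. prefix s t}"

lemma leaves_initial_segments:
  assumes "prefix_free L"
  shows "leaves (initial_segments L) = L"
proof (intro equalityI subsetI)
  fix t assume t: "t \<in> leaves (initial_segments L)"
  then obtain u where u: "u \<in> L" "prefix t u" by (auto simp: leaves_def initial_segments_def)
  then have "u \<in> initial_segments L" by (auto simp: initial_segments_def)
  with t u show "t \<in> L" by (auto simp: leaves_def strict_prefix_def)
next
  fix t assume "t \<in> L"
  moreover have "\<not> strict_prefix t s" if "prefix s u" "u \<in> L" for s u
    using prefix_freeD[OF assms \<open>t \<in> L\<close> that(2)] that(1)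
    by (metis prefix_order.less_le prefix_order.less_le_trans)
  ultimately show "t \<in> leaves (initial_segments L)"
    by (auto simp: leaves_def initial_segments_def)
qed

text \<open>
  Every node of a finite tree lies below a leaf, namely below any longest node extending it.
\<close>
lemma initial_segments_leaves:
  assumes "finite T" "initial_closed T"
  shows "initial_segments (leaves T) = T"
proof (intro equalityI subsetI)
  fix s assume "s \<in> initial_segments (leaves T)"
  then show "s \<in> T" using assms(2) by (auto simp: initial_segments_def leaves_def initial_closed_def)
next
  fix s assume s: "s \<in> T"
  define E where "E = {t \<in> T. prefix s t}"
  have "finite E" "s \<in> E" using assms(1) s by (auto simp: E_def)
  then have "Max (length ` E) \<in> length ` E" by (intro Max_in) auto
  then obtain t where t: "t \<in> E" and len: "length t = Max (length ` E)" by auto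
  have max: "length u \<le> length t" if "u \<in> E" for u
    using that \<open>finite E\<close> by (simp add: len)
  have "\<not> strict_prefix t u" if "u \<in> T" for u
  proof
    assume "strict_prefix t u"
    moreover from this have "u \<in> E" using t that by (auto simp: E_def)
    ultimately show False using max prefix_length_less by fastforce
  qed
  then show "s \<in> initial_segments (leaves T)"
    using t by (auto simp: E_def initial_segments_def leaves_def)
qed

lemma transverse_iff: "transverse A \<longleftrightarrow> inj_on length A"
  by (auto simp: transverse_def inj_on_def)

lemma diagonal_iff: "diagonal A \<longleftrightarrow> prefix_free A \<and> inj_on length (meet_closure A)"
  unfolding diagonal_def transverse_iff prefix_free_def parallel_def by blast

lemma length_meet_closure_le:
  assumes "\<forall>t\<in>L. length t \<le> n" "s \<in> meet_closure L"
  shows "length s \<le> n"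
  using assms prefix_length_le[OF longest_common_prefix_prefix1] order_trans
  unfolding meet_closure_iff by blast

lemma sparse_type_finite: 
  assumes "sparse_type m T" shows "finite T"
proof (rule finite_subset)
  show "T \<subseteq> {s. set s \<subseteq> UNIV \<and> length s \<le> 2 * m - 2}"
    using assms by (auto simp: sparse_type_def)
qed (rule finite_lists_length_le, simp)

text \<open>
  The \<open>2 * m - 1\<close> meets of the \<open>m\<close> leaves have distinct lengths among the \<open>2 * m - 1\<close> numbers
  \<open>0, \<dots>, 2 * m - 2\<close>, so they occupy every level.  Hence each 1 of a leaf sits at the level of some
  meet, and sparseness forces that meet to be an initial segment of the leaf.
\<close>
lemma leaves_sparse_type_in_sparse_diags_on:
  assumes "sparse_type m T" "m \<ge> 1"
  shows "leaves T \<in> sparse_diags_on {..2 * m - 2}"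
proof -
  define L where "L = leaves T"
  have L: "\<forall>t\<in>L. length t \<le> 2 * m - 2" "finite L" "card L = m" "sparse L" "prefix_free L"
    and inj: "inj_on length (meet_closure L)"
    using assms(1) by (auto simp: sparse_type_def L_def leaves_def diagonal_iff)
  have ne: "L \<noteq> {}" using L(3) assms(2) by auto
  have "length ` meet_closure L \<subseteq> {..2 * m - 2}"
    using length_meet_closure_le[OF L(1)] by auto
  moreover have "card (length ` meet_closure L) = card {..2 * m - 2}"
    using card_meet_closure[OF L(2) ne L(5)] L(3) assms(2) unfolding card_image[OF inj] card_atMost
    by linarith
  ultimately have levels: "length ` meet_closure L = {..2 * m - 2}"
    by (intro card_subset_eq) auto
  have "take l t \<in> meet_closure L" if t: "t \<in> L" "l < length t" "t ! l" for t l
  proof -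
    have "l \<in> length ` meet_closure L"
      using t L(1) unfolding levels by fastforce
    then obtain s where s: "s \<in> meet_closure L" "length s = l" by auto
    then have "prefix s t" using L(4) t by (auto simp: sparse_def)
    then show ?thesis using s by (auto simp: prefix_def)
  qed
  then have "ones_at_meets L" by (simp add: ones_at_meets_def)
  then show ?thesis using L(5) inj ne levels by (simp add: sparse_diags_on_def sparse_diag_def L_def)
qed

text \<open>
  Conversely, \<open>2 * m - 1\<close> meets mean \<open>m\<close> leaves; and a meet at the level of a 1 of a leaf
  is, by transversality, the branching node of that leaf which carries the 1.
\<close>
lemma sparse_type_initial_segments:
  assumes "L \<in> sparse_diags_on {..2 * m - 2}" "m \<ge> 1"
  shows "sparse_type m (initial_segments L)"
proof -
  have L: "L \<noteq> {}" "prefix_free L" "inj_on length (meet_closure L)" "ones_at_meets L"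
    and levels: "length ` meet_closure L = {..2 * m - 2}"
    using assms(1) by (auto simp: sparse_diags_on_def sparse_diag_def)
  have lv: "leaves (initial_segments L) = L" by (rule leaves_initial_segments[OF L(2)])
  have len: "length t \<le> 2 * m - 2" if "t \<in> L" for t
    using that subset_meet_closure levels by blast
  have "finite (meet_closure L)"
    using L(3) levels by (intro finite_imageD[of length]) simp_all
  then have fin: "finite L" using subset_meet_closure finite_subset by blast
  have "2 * card L = Suc (card (meet_closure L))"
    using card_meet_closure[OF fin L(1,2)] by simp
  also have "card (meet_closure L) = card {..2 * m - 2}"
    using card_image[OF L(3)] levels by simp
  finally have card: "card L = m" using assms(2) unfolding card_atMost by linarith
  have "prefix s t" if "t \<in> L" "s \<in> meet_closure L" "length s < length t" "t ! length s" for s t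
  proof -
    have "take (length s) t \<in> meet_closure L"
      using L(4) that by (auto simp: ones_at_meets_def)
    moreover have "length (take (length s) t) = length s" using that by simp
    ultimately have "take (length s) t = s" using inj_onD[OF L(3)] that(2) by blast
    then show ?thesis by (metis take_is_prefix)
  qed
  then have "sparse L" by (auto simp: sparse_def)
  moreover have "initial_segments L \<subseteq> {s. length s \<le> 2 * m - 2}"
    using len prefix_length_le by (fastforce simp: initial_segments_def)
  moreover have "initial_closed (initial_segments L)"
    by (auto simp: initial_closed_def initial_segments_def intro: prefix_order.trans)
  ultimately show ?thesis
    using L fin card by (simp add: sparse_type_def lv diagonal_iff)
qed

lemma bij_betw_leaves:
  assumes "m \<ge> 1"
  shows "bij_betw leaves {T. sparse_type m T} (sparse_diags_on {..2 * m - 2})"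
proof (rule bij_betw_byWitness[where f' = initial_segments])
  show "\<forall>T\<in>{T. sparse_type m T}. initial_segments (leaves T) = T"
  proof
    fix T assume "T \<in> {T. sparse_type m T}"
    then have "sparse_type m T" by simp
    then show "initial_segments (leaves T) = T"
      using initial_segments_leaves sparse_type_finite unfolding sparse_type_def by blast
  qed
  show "\<forall>L\<in>sparse_diags_on {..2 * m - 2}. leaves (initial_segments L) = L"
    by (simp add: sparse_diags_on_def sparse_diag_def leaves_initial_segments)
  show "leaves ` {T. sparse_type m T} \<subseteq> sparse_diags_on {..2 * m - 2}"
    using leaves_sparse_type_in_sparse_diags_on[OF _ assms] by blast
  show "initial_segments ` sparse_diags_on {..2 * m - 2} \<subseteq> {T. sparse_type m T}"
    using sparse_type_initial_segments[OF _ assms] by blast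
qed

section \<open>Existence of vip orders\<close>

text \<open>
  Compare nodes by length and, within a level, by the length of their meet with the distinguished
  node of that level, the distinguished node itself coming first.  The remaining ties may be broken
  arbitrarily.
\<close>
lemma vip_order_exists:
  assumes "finite T" "meet_closure D \<subseteq> T" "transverse (meet_closure D)"
  shows "\<exists>r. vip_order D T r"
proof -
  define M where "M = meet_closure D"
  \<comment> \<open>On a level without an element of \<open>M\<close> this is an arbitrary sequence; no condition is imposed there.\<close>
  define node where "node n = (SOME d. d \<in> M \<and> length d = n)" for n
  have node: "node (length d) = d" if "d \<in> M" for d
    unfolding node_def using that assms(3) by (intro some_equality) (auto simp: M_def transverse_def)
  define key where "key u = (if u \<in> M then 0 else Suc (length (meet (node (length u)) u)))" for u
  \<comment> \<open>The numbering \<open>f\<close> serves only to break ties.\<close>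
  obtain f :: "bool list \<Rightarrow> nat" where f: "inj_on f T"
    using assms(1) finite_imp_inj_to_nat_seg by metis
  define r where "r = {(u, v). u \<in> T \<and> v \<in> T \<and>
     (length u < length v \<or> length u = length v \<and> (key u < key v \<or> key u = key v \<and> f u < f v))}"
  have rT: "r \<subseteq> T \<times> T" by (auto simp: r_def)
  have tr: "trans r" by (auto simp: trans_def r_def)
  have ir: "irrefl r" by (auto simp: irrefl_def r_def)
  have tot: "total_on T r"
    unfolding total_on_def r_def using f[THEN inj_onD] by clarsimp (meson linorder_neqE_nat)
  have "acyclic r" using tr ir by (simp add: acyclic_irrefl trancl_id)
  then have "wf r" using finite_subset[OF rT] assms(1) by (simp add: finite_acyclic_wf)
  then have "wf (Restr r (level T n))" for n by (rule wf_subset) auto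
  then have lwo: "level_well_ordering T r"
    unfolding level_well_ordering_def strict_linear_order_on_def
    using rT tr ir tot by (auto simp: r_def)
  \<comment> \<open>Off the distinguished node of its level, a node lies outside \<open>M\<close>, since \<open>M\<close> is transverse.\<close>
  have off: "key u = Suc (length (meet d u))"
    if "d \<in> M" "u \<in> level T (length d) - {d}" for d u
  proof -
    have "length u = length d" "u \<noteq> d" using that by (auto simp: level_def)
    moreover from this have "u \<notin> M" using assms(3) that(1) by (auto simp: M_def transverse_def)
    ultimately show ?thesis using node[OF that(1)] by (simp add: key_def)
  qed
  have "(d, u) \<in> r" if "d \<in> M" "u \<in> level T (length d) - {d}" for d u
  proof -
    have "key d < key u" using that off by (simp add: key_def)
    then show ?thesis using that assms(2) by (auto simp: r_def level_def M_def)
  qed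
  moreover have "(u, v) \<in> r"
    if "d \<in> M" "u \<in> level T (length d) - {d}" "v \<in> level T (length d) - {d}"
      "strict_prefix (meet d u) (meet d v)" for d u v
  proof -
    have "key u < key v" using that off prefix_length_less by simp
    then show ?thesis using that by (auto simp: r_def level_def)
  qed
  ultimately have "vip_order D T r"
    unfolding vip_order_def using lwo assms(2) by (auto simp: M_def)
  then show ?thesis ..
qed

lemma sparse_type_vip_order_exists:
  assumes "sparse_type m T"
  shows "\<exists>r. vip_order (leaves T) T r"
proof (rule vip_order_exists)
  show "finite T" using assms by (rule sparse_type_finite)
  show "meet_closure (leaves T) \<subseteq> T"
    using assms longest_common_prefix_prefix1
    by (fastforce simp: sparse_type_def initial_closed_def meet_closure_iff leaves_def)
  show "transverse (meet_closure (leaves T))"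
    using assms by (simp add: sparse_type_def diagonal_def)
qed

section \<open>Counting sparse types\<close>

theorem corollary6p8:
  fixes m :: nat
  assumes "m \<ge> 2"
  shows "finite {\<tau>. sparse_type m \<tau>} \<and>
         real (card {\<tau>. sparse_type m \<tau>}) = tangent_number m \<and>
         finite {p. sparse_vip_type m p} \<and>
         tangent_number m \<le> real (card {p. sparse_vip_type m p})"
proof -
  let ?S = "{\<tau>. sparse_type m \<tau>}" and ?V = "{p. sparse_vip_type m p}"
  have bij: "bij_betw leaves ?S (sparse_diags_on {..2 * m - 2})"
    using assms by (intro bij_betw_leaves) simp
  have finS: "finite ?S" using bij_betw_finite[OF bij] finite_sparse_diags_on by simp
  have "2 * m - 1 = Suc (2 * m - 2)" using assms by simp
  then have cardS: "real (card ?S) = tangent_number m"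
    using bij_betw_same_card[OF bij] by (simp add: card_sparse_diags_on tangent_number_def tan_coeff_def)
  have "?V \<subseteq> (SIGMA \<tau> : ?S. Pow (\<tau> \<times> \<tau>))"
    by (auto simp: sparse_vip_type_def vip_order_def level_well_ordering_def)
  then have finV: "finite ?V"
    by (rule finite_subset) (use finS sparse_type_finite in auto)
  \<comment> \<open>Every sparse type carries at least one vip order, so the first projection reaches every type.\<close>
  have "?S \<subseteq> fst ` ?V"
    using sparse_type_vip_order_exists by (force simp: sparse_vip_type_def)
  then have "card ?S \<le> card ?V"
    using finV card_mono card_image_le by (meson finite_imageI le_trans)
  then show ?thesis using finS cardS finV by simp
qed

end
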